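(* For a GPT error profile $F$ on three hypotheses, define $$\beta=F(\{1,2,3\})-F(\{1,2\})-F(\{1,3\})-F(\{2,3\}).$$ The profile belongs to the classical region $\mathfrak C_3$ if and only if $\beta\le0$. The maximum of $\beta$ over $\mathfrak C_3$ is $0$ and its maximum over $\mathfrak G_3$ is $1$; the latter is attained only at the profile with $F(\{1,2\})=F(\{1,3\})=F(\{2,3\})=0$ and $F(\{1,2,3\})=1$.
   Context: A finite-dimensional GPT state space is a nonempty compact convex subset $K$ of some $\mathbb R^d$, $d\ge1$. A (finite-outcome) measurement on $K$ is a finite family $(e_x)_{x\in X}$ of nonnegative affine functions on $K$ with $\sum_{x}e_x=1$; every such family is allowed. For a list of (not necessarily distinct) states $s_1,s_2,s_3\in K$ and nonempty $H\subseteq\{1,2,3\}$, $D(H)=\max\sum_{i\in H}e_i(s_i)$, the maximum over all measurements $(e_i)_{i\in H}$ indexed by $H$, and $F(H)=|H|-D(H)$. $F$ is the error profile of the list. The GPT region $\mathfrak G_3\subset\mathbb R^4$ is the set of all vectors $(F(\{1,2\}),F(\{1,3\}),F(\{2,3\}),F(\{1,2,3\}))$ arising from lists of three states in all finite-dimensional GPT state spaces. The classical region $\mathfrak C_3$ is the set of those vectors arising from lists of three states in the probability simplexes $K=\Delta_m=\{p\in\mathbb R^m:p_j\ge0,\ \sum_jp_j=1\}$, $m\ge1$. *)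

theory Defs
  imports "HOL-Analysis.Analysis"
begin

text \<open>
  The dimension of the ambient space ranges over all positive integers, so it cannot be a type.
  Points of real \<open>d\<close>-space are therefore functions \<open>nat \<Rightarrow> real\<close> that vanish at all indices
  \<open>\<ge> d\<close>, as in the library's \<^const>\<open>Euclidean_space\<close>. As \<open>nat \<Rightarrow> real\<close> is not an instance of
  \<^class>\<open>real_vector\<close>, convex combinations are written out coordinatewise.
\<close>

definition mix :: "real \<Rightarrow> (nat \<Rightarrow> real) \<Rightarrow> (nat \<Rightarrow> real) \<Rightarrow> nat \<Rightarrow> real" where
  "mix u x y = (\<lambda>i. (1 - u) * x i + u * y i)"

definition convex_coord :: "(nat \<Rightarrow> real) set \<Rightarrow> bool" where
  "convex_coord K \<longleftrightarrow> (\<forall>x\<in>K. \<forall>y\<in>K. \<forall>u\<in>{0..1}. mix u x y \<in> K)"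

definition state_space :: "nat \<Rightarrow> (nat \<Rightarrow> real) set \<Rightarrow> bool" where
  "state_space d K \<longleftrightarrow> K \<noteq> {} \<and> compactin (Euclidean_space d) K \<and> convex_coord K"

definition affine_fun_on :: "(nat \<Rightarrow> real) set \<Rightarrow> ((nat \<Rightarrow> real) \<Rightarrow> real) \<Rightarrow> bool" where
  "affine_fun_on K f \<longleftrightarrow>
     (\<forall>x\<in>K. \<forall>y\<in>K. \<forall>u\<in>{0..1}. f (mix u x y) = (1 - u) * f x + u * f y)"

text \<open>Only the values of the effects at points of \<open>K\<close> matter.\<close>

definition measurement ::
    "(nat \<Rightarrow> real) set \<Rightarrow> 'i set \<Rightarrow> ('i \<Rightarrow> (nat \<Rightarrow> real) \<Rightarrow> real) \<Rightarrow> bool" where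
  "measurement K X e \<longleftrightarrow> finite X
     \<and> (\<forall>x\<in>X. affine_fun_on K (e x) \<and> (\<forall>s\<in>K. 0 \<le> e x s))
     \<and> (\<forall>s\<in>K. (\<Sum>x\<in>X. e x s) = 1)"

text \<open>
  The supremum below is a maximum for every finite nonempty family of states in a convex \<open>K\<close>:
  see \<open>D_upper\<close> and \<open>D_attained\<close>.
\<close>

definition D :: "(nat \<Rightarrow> real) set \<Rightarrow> ('i \<Rightarrow> nat \<Rightarrow> real) \<Rightarrow> 'i set \<Rightarrow> real" where
  "D K s H = Sup {(\<Sum>i\<in>H. e i (s i)) | e. measurement K H e}"

definition F :: "(nat \<Rightarrow> real) set \<Rightarrow> ('i \<Rightarrow> nat \<Rightarrow> real) \<Rightarrow> 'i set \<Rightarrow> real" where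
  "F K s H = real (card H) - D K s H"

type_synonym profile = "real \<times> real \<times> real \<times> real"

definition profile :: "(nat \<Rightarrow> real) set \<Rightarrow> (nat \<Rightarrow> nat \<Rightarrow> real) \<Rightarrow> profile" where
  "profile K s = (F K s {1, 2}, F K s {1, 3}, F K s {2, 3}, F K s {1, 2, 3})"

definition gpt_region :: "profile set" where
  "gpt_region = {profile K s | d K s. 1 \<le> d \<and> state_space d K \<and> s ` {1, 2, 3} \<subseteq> K}"

definition prob_simplex :: "nat \<Rightarrow> (nat \<Rightarrow> real) set" where
  "prob_simplex m = {p \<in> topspace (Euclidean_space m). (\<forall>j<m. 0 \<le> p j) \<and> (\<Sum>j<m. p j) = 1}"

definition classical_region :: "profile set" where
  "classical_region = {profile (prob_simplex m) s | m s. 1 \<le> m \<and> s ` {1, 2, 3} \<subseteq> prob_simplex m}"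

fun beta :: "profile \<Rightarrow> real" where
  "beta (f12, f13, f23, f123) = f123 - f12 - f13 - f23"

lemma measurement_le_1:
  assumes "measurement K H e" "i \<in> H" "x \<in> K"
  shows "e i x \<le> 1"
proof -
  have "e i x \<le> (\<Sum>j\<in>H. e j x)"
    using assms by (intro member_le_sum) (auto simp: measurement_def)
  then show ?thesis
    using assms by (auto simp: measurement_def)
qed

lemma D_upper:
  assumes "s ` H \<subseteq> K" "measurement K H e"
  shows "(\<Sum>i\<in>H. e i (s i)) \<le> D K s H"
  unfolding D_def
proof (rule cSup_upper)
  show "(\<Sum>i\<in>H. e i (s i)) \<in> {(\<Sum>i\<in>H. e i (s i)) | e. measurement K H e}"
    using assms by blast
  have "(\<Sum>i\<in>H. e i (s i)) \<le> real (card H) * 1" if "measurement K H e" for e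
    using measurement_le_1[OF that] assms(1) by (intro sum_bounded_above) auto
  then show "bdd_above {(\<Sum>i\<in>H. e i (s i)) | e. measurement K H e}"
    by (intro bdd_aboveI) auto
qed

lemma D_attained:
  assumes sK: "s ` H \<subseteq> K" and H: "finite H" "H \<noteq> {}" and K: "convex_coord K"
  shows "\<exists>e. measurement K H e \<and> (\<Sum>i\<in>H. e i (s i)) = D K s H"
proof -
  define P :: "('a \<times> (nat \<Rightarrow> real) \<Rightarrow> real) set" where "P = PiE UNIV (\<lambda>_. {0..1})"
  define M where "M = {g. measurement K H (\<lambda>i x. g (i, x))}"
  define val where "val = (\<lambda>g :: 'a \<times> (nat \<Rightarrow> real) \<Rightarrow> real. \<Sum>i\<in>H. g (i, s i))"
  have "compact P"
    using compactin_PiE[of "\<lambda>_. euclideanreal" UNIV "\<lambda>_. {0..1::real}"]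
    unfolding P_def euclidean_product_topology compactin_euclidean_iff by simp
  moreover have "closed M"
  proof -
    have "closed {g. affine_fun_on K (\<lambda>x. g (i, x)) \<and> (\<forall>s\<in>K. 0 \<le> g (i, s))}" for i :: 'a
      unfolding affine_fun_on_def Ball_def
      by (intro closed_Collect_conj closed_Collect_all closed_Collect_imp closed_Collect_eq
            closed_Collect_le open_Collect_const continuous_intros continuous_on_product_coordinates)
    moreover have "closed {g. \<forall>x\<in>K. (\<Sum>i\<in>H. g (i, x)) = (1::real)}"
      unfolding Ball_def
      by (intro closed_Collect_all closed_Collect_imp closed_Collect_eq
            open_Collect_const continuous_intros continuous_on_product_coordinates)
    ultimately show ?thesis
      unfolding M_def measurement_def using H(1)
      by (simp add: Ball_def closed_Collect_conj closed_Collect_all closed_Collect_imp)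
  qed
  ultimately have cpt: "compact (P \<inter> M)"
    by blast
  have rep: "\<exists>g\<in>P \<inter> M. val g = (\<Sum>i\<in>H. e i (s i))" if e: "measurement K H e" for e
  proof
    let ?g = "\<lambda>(i, x). if i \<in> H \<and> x \<in> K then e i x else 0"
    show "?g \<in> P \<inter> M"
      using e measurement_le_1[OF e] K
      by (auto simp: P_def M_def measurement_def affine_fun_on_def convex_coord_def)
    show "val ?g = (\<Sum>i\<in>H. e i (s i))"
      unfolding val_def using sK by (intro sum.cong) auto
  qed
  have "measurement K H (\<lambda>i x. 1 / real (card H))"
    using H by (auto simp: measurement_def affine_fun_on_def simp flip: add_divide_distrib)
  then have "P \<inter> M \<noteq> {}"
    using rep by blast
  moreover have "continuous_on (P \<inter> M) val"
    unfolding val_def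
    by (intro continuous_on_sum continuous_on_subset[OF continuous_on_product_coordinates]) auto
  ultimately obtain g where g: "g \<in> P \<inter> M" "\<And>h. h \<in> P \<inter> M \<Longrightarrow> val h \<le> val g"
    using continuous_attains_sup[OF cpt] by blast
  have m: "measurement K H (\<lambda>i x. g (i, x))"
    using g(1) by (simp add: M_def)
  have "D K s H = val g"
    unfolding D_def
  proof (rule cSup_eq_maximum)
    show "val g \<in> {(\<Sum>i\<in>H. e i (s i)) | e. measurement K H e}"
      using m by (auto simp: val_def)
    fix y assume "y \<in> {(\<Sum>i\<in>H. e i (s i)) | e. measurement K H e}"
    then show "y \<le> val g"
      using rep g(2) by force
  qed
  then show ?thesis
    using m by (auto simp: val_def)
qed

end

theory Submission
  imports Defs
begin

text \<open>
  Classically \<open>\<beta> = - (\<Sum>j. min (p\<^sub>1 j) (p\<^sub>2 j) (p\<^sub>3 j)) \<le> 0\<close>. Conversely, every profile satisfies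
  \<open>F\<^sub>i\<^sub>k + F\<^sub>j\<^sub>k \<le> F\<^sub>1\<^sub>2\<^sub>3\<close> (test \<open>i\<close> against \<open>k\<close> with the effect \<open>e\<^sub>i\<close>, and \<open>j\<close> against \<open>k\<close> with \<open>e\<^sub>j\<close>) and
  \<open>F\<^sub>1\<^sub>2\<^sub>3 \<le> 1 + F\<^sub>i\<^sub>j\<close> (ignore the third hypothesis). If \<open>\<beta> \<le> 0\<close>, these inequalities say precisely that
  three distributions with triple overlap \<open>-\<beta>\<close> and exclusive pairwise overlaps \<open>F\<^sub>i\<^sub>j + \<beta>\<close> exist.
  The second inequality and \<open>F\<^sub>i\<^sub>j \<ge> 0\<close> also give \<open>\<beta> \<le> 1\<close> with its equality case; three vertices of a square
  attain it.
\<close>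

section \<open>Inequalities for arbitrary state spaces\<close>

lemma D_le_card:
  assumes "s ` H \<subseteq> K" "finite H" "H \<noteq> {}" "convex_coord K"
  shows "D K s H \<le> real (card H)"
proof -
  obtain e where e: "measurement K H e" "(\<Sum>i\<in>H. e i (s i)) = D K s H"
    using D_attained[OF assms] by blast
  have "(\<Sum>i\<in>H. e i (s i)) \<le> real (card H) * 1"
    using measurement_le_1[OF e(1)] assms(1) by (intro sum_bounded_above) auto
  then show ?thesis
    using e(2) by simp
qed

lemma D_mono:
  assumes "A \<subseteq> B" "A \<noteq> {}" "finite B" "s ` B \<subseteq> K" "convex_coord K"
  shows "D K s A \<le> D K s B"
proof -
  have A: "s ` A \<subseteq> K" "finite A"
    using assms finite_subset by auto
  obtain e where e: "measurement K A e" "(\<Sum>i\<in>A. e i (s i)) = D K s A"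
    using D_attained[OF A assms(2,5)] by blast
  \<comment> \<open>Outcomes outside \<open>A\<close> get the zero effect, so the optimal
    measurement for \<open>A\<close> competes for \<open>B\<close>.\<close>
  define g where "g = (\<lambda>i x. if i \<in> A then e i x else 0)"
  have sum_g: "(\<Sum>i\<in>B. g i (t i)) = (\<Sum>i\<in>A. e i (t i))" for t
    unfolding g_def using assms(1,3) by (intro sum.mono_neutral_cong_right) auto
  have "measurement K B g"
    using e(1) assms(3) sum_g[of "\<lambda>_. x" for x]
    by (auto simp: measurement_def) (auto simp: g_def affine_fun_on_def)
  then show ?thesis
    using D_upper[OF assms(4)] sum_g[of s] e(2) by fastforce
qed

lemma D_pair_ge:
  assumes f: "affine_fun_on K f" "\<And>x. x \<in> K \<Longrightarrow> 0 \<le> f x \<and> f x \<le> 1"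
    and s: "s i \<in> K" "s k \<in> K" "i \<noteq> k"
  shows "f (s i) + 1 - f (s k) \<le> D K s {i, k}"
proof -
  define e where "e = (\<lambda>j x. if j = i then f x else 1 - f x)"
  have "measurement K {i, k} e"
    using f s(3) by (auto simp: measurement_def e_def affine_fun_on_def algebra_simps)
  then have "(\<Sum>j\<in>{i, k}. e j (s j)) \<le> D K s {i, k}"
    using s by (intro D_upper) auto
  then show ?thesis
    using s(3) by (simp add: e_def)
qed

lemma D_triple_le:
  assumes "s ` {i, j, k} \<subseteq> K" "convex_coord K" "i \<noteq> j" "i \<noteq> k" "j \<noteq> k"
  shows "D K s {i, j, k} + 1 \<le> D K s {i, k} + D K s {j, k}"
proof -
  obtain e where e: "measurement K {i, j, k} e" "(\<Sum>l\<in>{i, j, k}. e l (s l)) = D K s {i, j, k}"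
    using D_attained[OF assms(1) _ _ assms(2)] by blast
  have "e l (s l) + 1 - e l (s k) \<le> D K s {l, k}" if "l \<in> {i, j}" for l
    using e(1) measurement_le_1[OF e(1)] that assms
    by (intro D_pair_ge) (auto simp: measurement_def)
  then have "e i (s i) + 1 - e i (s k) + (e j (s j) + 1 - e j (s k)) \<le> D K s {i, k} + D K s {j, k}"
    by (intro add_mono) auto
  \<comment> \<open>Normalisation at \<open>s k\<close> turns the subtracted terms into
    \<open>e k (s k) - 1\<close>, which supplies the missing third success probability.\<close>
  moreover have "e i (s k) + e j (s k) + e k (s k) = 1"
    using e(1) assms by (auto simp: measurement_def)
  ultimately show ?thesis
    using e(2) assms(3-5) by simp
qed

lemma gpt_profile_bounds:
  assumes "(f12, f13, f23, f123) \<in> gpt_region"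
  shows "0 \<le> f12" "0 \<le> f13" "0 \<le> f23"
    and "f12 + f13 \<le> f123" "f12 + f23 \<le> f123" "f13 + f23 \<le> f123"
    and "f123 \<le> 1 + f12" "f123 \<le> 1 + f13" "f123 \<le> 1 + f23"
proof -
  obtain d K s where K: "state_space d K" and s: "s ` {1, 2, 3} \<subseteq> K"
    and p: "(f12, f13, f23, f123) = profile K s"
    using assms by (auto simp: gpt_region_def)
  have c: "convex_coord K"
    using K by (simp add: state_space_def)
  note f = p[unfolded profile_def F_def, simplified]
  show "0 \<le> f12" "0 \<le> f13" "0 \<le> f23"
    using D_le_card[of s "{1, 2}" K] D_le_card[of s "{1, 3}" K] D_le_card[of s "{2, 3}" K] s c f
    by auto
  show "f123 \<le> 1 + f12" "f123 \<le> 1 + f13" "f123 \<le> 1 + f23"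
    using D_mono[of "{1, 2}" "{1, 2, 3}" s K] D_mono[of "{1, 3}" "{1, 2, 3}" s K]
      D_mono[of "{2, 3}" "{1, 2, 3}" s K] s c f
    by auto
  show "f12 + f13 \<le> f123" "f12 + f23 \<le> f123" "f13 + f23 \<le> f123"
    using D_triple_le[of s 2 3 1 K] D_triple_le[of s 1 3 2 K] D_triple_le[of s 1 2 3 K] s c f
    by (auto simp: insert_commute)
qed

section \<open>Classical state spaces\<close>

definition simplex_vertex :: "nat \<Rightarrow> nat \<Rightarrow> real" where
  "simplex_vertex j = (\<lambda>i. if i = j then 1 else 0)"

lemma prob_simplex_iff:
  "p \<in> prob_simplex m \<longleftrightarrow> (\<forall>i\<ge>m. p i = 0) \<and> (\<forall>j<m. 0 \<le> p j) \<and> (\<Sum>j<m. p j) = 1"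
  by (auto simp: prob_simplex_def topspace_Euclidean_space)

lemma simplex_vertex_in: "j < m \<Longrightarrow> simplex_vertex j \<in> prob_simplex m"
  by (auto simp: prob_simplex_iff simplex_vertex_def)

lemma prob_simplex_mono: "k \<le> m \<Longrightarrow> prob_simplex k \<subseteq> prob_simplex m"
proof
  fix p assume k: "k \<le> m" and p: "p \<in> prob_simplex k"
  have "(\<Sum>j<m. p j) = (\<Sum>j<k. p j)"
    using k p by (intro sum.mono_neutral_right) (auto simp: prob_simplex_iff)
  moreover have "0 \<le> p j" for j
    using p by (cases "j < k") (auto simp: prob_simplex_iff)
  ultimately show "p \<in> prob_simplex m"
    using k p by (auto simp: prob_simplex_iff)
qed

text \<open>Effects are affine only for two-point mixtures, so the vertices are split off one at a
  time, by induction on \<open>m\<close>; zero padding makes the simplexes nested.\<close>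

lemma affine_on_simplex:
  assumes "affine_fun_on (prob_simplex m) f" "p \<in> prob_simplex m"
  shows "f p = (\<Sum>j<m. p j * f (simplex_vertex j))"
  using assms
proof (induction m arbitrary: p)
  case 0
  then show ?case by (simp add: prob_simplex_iff)
next
  case (Suc m)
  have aff: "affine_fun_on (prob_simplex m) f"
    using Suc.prems(1) subsetD[OF prob_simplex_mono[of m "Suc m"]] by (simp add: affine_fun_on_def)
  have p: "0 \<le> p j" for j
    using Suc.prems(2) by (cases "j < Suc m") (auto simp: prob_simplex_iff)
  have pm: "(\<Sum>j<m. p j) = 1 - p m"
    using Suc.prems(2) by (simp add: prob_simplex_iff)
  have le1: "p m \<le> 1"
    using pm sum_nonneg[of "{..<m}" p] p by simp
  show ?case
  proof (cases "p m = 1")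
    case True
    have "p j = 0" if "j < m" for j
      using pm True p that by (simp add: sum_nonneg_eq_0_iff)
    moreover from this have "p = simplex_vertex m"
      using True Suc.prems(2) by (force simp: simplex_vertex_def prob_simplex_iff less_Suc_eq_le
          not_less_eq_eq[symmetric] linorder_neq_iff)
    ultimately show ?thesis
      using True by simp
  next
    case False
    \<comment> \<open>The rest of \<open>p\<close> after removing vertex \<open>m\<close>,
      renormalised; this is why \<open>p m = 1\<close> is treated separately.\<close>
    define q where "q = (\<lambda>j. if j < m then p j / (1 - p m) else 0)"
    have q: "q \<in> prob_simplex m"
      using False le1 p pm by (auto simp: q_def prob_simplex_iff simp flip: sum_divide_distrib)
    have "p = mix (p m) q (simplex_vertex m)"
    proof
      fix i
      have "i < m \<or> i = m \<or> Suc m \<le> i" by arith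
      then show "p i = mix (p m) q (simplex_vertex m) i"
        using False Suc.prems(2) by (auto simp: mix_def q_def simplex_vertex_def prob_simplex_iff)
    qed
    moreover have "f (mix (p m) q (simplex_vertex m)) = (1 - p m) * f q + p m * f (simplex_vertex m)"
      using Suc.prems(1) q prob_simplex_mono[of m "Suc m"] simplex_vertex_in[of m "Suc m"] p le1
      unfolding affine_fun_on_def by auto
    moreover have "(1 - p m) * f q = (\<Sum>j<m. p j * f (simplex_vertex j))"
      unfolding Suc.IH[OF aff q] sum_distrib_left using False by (intro sum.cong) (auto simp: q_def)
    ultimately show ?thesis
      by simp
  qed
qed

text \<open>Maximum-likelihood guessing is optimal: for any measurement, the values at vertex
  \<open>j\<close> are weights summing to 1, so outcome \<open>j\<close> contributes at most the
  largest \<open>s i j\<close>.\<close>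

lemma D_prob_simplex:
  assumes H: "finite H" "H \<noteq> {}" and s: "s ` H \<subseteq> prob_simplex m"
  shows "D (prob_simplex m) s H = (\<Sum>j<m. Max ((\<lambda>i. s i j) ` H))"
  unfolding D_def
proof (rule cSup_eq_maximum)
  have "\<exists>i\<in>H. s i j = Max ((\<lambda>i. s i j) ` H)" for j
    using Max_in[of "(\<lambda>i. s i j) ` H"] H by (auto simp: image_iff)
  \<comment> \<open>\<open>c\<close> is the guessing rule. It fixes one maximiser per outcome, so
    ties cannot spoil normalisation of the effects.\<close>
  then obtain c where c: "c j \<in> H" "s (c j) j = Max ((\<lambda>i. s i j) ` H)" for j
    by metis
  define e where "e = (\<lambda>i p. \<Sum>j<m. if c j = i then p j else (0::real))"
  have sum_e: "(\<Sum>i\<in>H. e i (t i)) = (\<Sum>j<m. t (c j) j)" for t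
    unfolding e_def by (subst sum.swap) (simp add: H c sum.delta')
  have "measurement (prob_simplex m) H e"
    unfolding measurement_def sum_e
    by (auto simp: H e_def affine_fun_on_def mix_def prob_simplex_iff sum_distrib_left
        simp flip: sum.distrib intro!: sum_nonneg sum.cong)
  then show "(\<Sum>j<m. Max ((\<lambda>i. s i j) ` H))
      \<in> {(\<Sum>i\<in>H. e i (s i)) | e. measurement (prob_simplex m) H e}"
    using sum_e[of s] c(2) by force
next
  fix y assume "y \<in> {(\<Sum>i\<in>H. e i (s i)) | e. measurement (prob_simplex m) H e}"
  then obtain e where e: "measurement (prob_simplex m) H e" and y: "y = (\<Sum>i\<in>H. e i (s i))"
    by blast
  have "y = (\<Sum>i\<in>H. \<Sum>j<m. s i j * e i (simplex_vertex j))"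
    unfolding y using e s by (intro sum.cong affine_on_simplex) (auto simp: measurement_def)
  also have "\<dots> = (\<Sum>j<m. \<Sum>i\<in>H. s i j * e i (simplex_vertex j))"
    by (rule sum.swap)
  also have "\<dots> \<le> (\<Sum>j<m. \<Sum>i\<in>H. Max ((\<lambda>i. s i j) ` H) * e i (simplex_vertex j))"
    using e H simplex_vertex_in
    by (intro sum_mono mult_right_mono) (auto simp: measurement_def)
  also have "\<dots> = (\<Sum>j<m. Max ((\<lambda>i. s i j) ` H))"
    using e simplex_vertex_in by (simp add: measurement_def flip: sum_distrib_left)
  finally show "y \<le> (\<Sum>j<m. Max ((\<lambda>i. s i j) ` H))" .
qed

lemma profile_prob_simplex:
  assumes "s ` {1, 2, 3} \<subseteq> prob_simplex m"
  shows "profile (prob_simplex m) s =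
    (2 - (\<Sum>j<m. max (s 1 j) (s 2 j)), 2 - (\<Sum>j<m. max (s 1 j) (s 3 j)),
     2 - (\<Sum>j<m. max (s 2 j) (s 3 j)), 3 - (\<Sum>j<m. max (s 1 j) (max (s 2 j) (s 3 j))))"
  using assms by (simp add: profile_def F_def D_prob_simplex)

lemma classical_beta_le_0:
  assumes "p \<in> classical_region"
  shows "beta p \<le> 0"
proof -
  obtain m s where s: "s ` {1, 2, 3} \<subseteq> prob_simplex m" and p: "p = profile (prob_simplex m) s"
    using assms by (auto simp: classical_region_def)
  \<comment> \<open>In each summand the right side exceeds the left by the minimum of the three
    weights. Total masses 1 turn the summed inequality into \<open>beta p \<le> 0\<close>.\<close>
  have "(\<Sum>j<m. max (s 1 j) (s 2 j) + max (s 1 j) (s 3 j) + max (s 2 j) (s 3 j))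
      \<le> (\<Sum>j<m. s 1 j + s 2 j + s 3 j + max (s 1 j) (max (s 2 j) (s 3 j)))"
  proof (intro sum_mono)
    fix j assume "j \<in> {..<m}"
    then have "0 \<le> s 1 j" "0 \<le> s 2 j" "0 \<le> s 3 j"
      using s by (auto simp: prob_simplex_iff)
    then show "max (s 1 j) (s 2 j) + max (s 1 j) (s 3 j) + max (s 2 j) (s 3 j)
        \<le> s 1 j + s 2 j + s 3 j + max (s 1 j) (max (s 2 j) (s 3 j))"
      by (auto simp: max_def)
  qed
  then show ?thesis
    using s unfolding p profile_prob_simplex[OF s] by (simp add: sum.distrib prob_simplex_iff)
qed

text \<open>
  The outcomes \<open>0, \<dots>, 6\<close> below are the seven nonempty sets of hypotheses
  \<open>123, 12, 13, 23, 1, 2, 3\<close>. On the outcome of a set, the distributions in that set have equal weight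
  and the others vanish.
\<close>

lemma classical_region_sufficient:
  assumes pairs: "f12 + f13 \<le> f123" "f12 + f23 \<le> f123" "f13 + f23 \<le> f123"
    and mass: "f123 \<le> 1 + f12" "f123 \<le> 1 + f13" "f123 \<le> 1 + f23"
    and beta: "f123 \<le> f12 + f13 + f23"
  shows "(f12, f13, f23, f123) \<in> classical_region"
proof -
  define t g12 g13 g23 where "t = f12 + f13 + f23 - f123"
    and "g12 = f12 - t" and "g13 = f13 - t" and "g23 = f23 - t"
  define r1 r2 r3 where "r1 = 1 - t - g12 - g13" and "r2 = 1 - t - g12 - g23"
    and "r3 = 1 - t - g13 - g23"
  note defs = t_def g12_def g13_def g23_def r1_def r2_def r3_def
  \<comment> \<open>Unfolded, \<open>g12 = f123 - f13 - f23\<close> and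
    \<open>r1 = 1 + f23 - f123\<close>, and symmetrically for the others. Thus \<open>beta\<close>
    gives the sign of \<open>t\<close>, \<open>pairs\<close> those of the \<open>g\<close>s and
    \<open>mass\<close> those of the \<open>r\<close>s.\<close>
  have nonneg: "0 \<le> t" "0 \<le> g12" "0 \<le> g13" "0 \<le> g23" "0 \<le> r1" "0 \<le> r2" "0 \<le> r3"
    using assms by (auto simp: defs)
  define row where "row = (\<lambda>i::nat. if i = 1 then [t, g12, g13, 0, r1, 0, 0]
    else if i = 2 then [t, g12, 0, g23, 0, r2, 0] else [t, 0, g13, g23, 0, 0, r3])"
  \<comment> \<open>The cutoff supplies the zeros beyond the ambient dimension and keeps
    \<open>!\<close> within the list.\<close>
  define s where "s = (\<lambda>i j. if j < 7 then row i ! j else 0)"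
  have sum7: "(\<Sum>j<7. h j) = h 0 + h 1 + h 2 + h 3 + h 4 + h 5 + h 6" for h :: "nat \<Rightarrow> real"
    by (simp add: eval_nat_numeral)
  have all7: "(\<forall>j<7. P j) \<longleftrightarrow> P 0 \<and> P 1 \<and> P 2 \<and> P 3 \<and> P 4 \<and> P 5 \<and> P 6"
    for P :: "nat \<Rightarrow> bool"
    by (simp add: eval_nat_numeral All_less_Suc) blast
  have s: "s ` {1, 2, 3} \<subseteq> prob_simplex 7"
    using nonneg unfolding prob_simplex_iff image_subset_iff ball_simps sum7 all7
    by (simp add: s_def row_def) (simp add: defs)
  have "profile (prob_simplex 7) s = (f12, f13, f23, f123)"
    unfolding profile_prob_simplex[OF s] sum7 using nonneg
    by (simp add: s_def row_def) (simp add: defs)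
  then show ?thesis
    using s unfolding classical_region_def
    by (intro CollectI exI[of _ "7::nat"] exI[of _ s]) auto
qed

section \<open>The square\<close>

definition unit_square :: "(nat \<Rightarrow> real) set" where
  "unit_square = {x. x 0 \<in> {0..1} \<and> x 1 \<in> {0..1} \<and> (\<forall>i\<ge>2. x i = 0)}"

definition corner :: "real \<Rightarrow> real \<Rightarrow> nat \<Rightarrow> real" where
  "corner a b = (\<lambda>i. if i = 0 then a else if i = 1 then b else 0)"

lemma state_space_unit_square: "state_space 2 unit_square"
proof -
  have "unit_square = PiE UNIV (\<lambda>i. if i < 2 then {0..1} else {0})"
    \<comment> \<open>As a product of compact factors, almost all of them \<open>{0}\<close>, the
      square is compact by Tychonoff.\<close>
    by (auto simp: unit_square_def PiE_iff less_2_cases_iff split: if_splits)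
  moreover have "compactin (powertop_real UNIV) (PiE UNIV (\<lambda>i. if i < 2 then {0..1} else {0}))"
    by (subst compactin_PiE) (auto simp: compactin_euclidean_iff)
  ultimately have "compactin (Euclidean_space 2) unit_square"
    by (auto simp: Euclidean_space_def compactin_subtopology) (auto simp: unit_square_def)
  moreover have "corner 0 0 \<in> unit_square"
    by (simp add: unit_square_def corner_def)
  moreover have "convex_coord unit_square"
  proof -
    have "(1 - u) * a + u * b \<in> {0..1}" if "a \<in> {0..1}" "b \<in> {0..1}" "u \<in> {0..1}" for a b u :: real
      using that convex_bound_le[of a 1 b "1 - u" u] by auto
    then show ?thesis
      by (auto simp: convex_coord_def unit_square_def mix_def)
  qed
  ultimately show ?thesis
    by (auto simp: state_space_def)
qed

lemma square_profile: "(0, 0, 0, 1) \<in> gpt_region"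
proof -
  define s where "s = (\<lambda>i::nat. if i = 1 then corner 0 0 else if i = 2 then corner 1 0 else corner 0 1)"
  let ?K = unit_square
  have corner_in: "corner a b \<in> ?K" if "a \<in> {0..1}" "b \<in> {0..1}" for a b
    using that by (auto simp: corner_def unit_square_def)
  then have s: "s ` {1, 2, 3} \<subseteq> ?K"
    by (auto simp: s_def)
  have K: "convex_coord ?K"
    using state_space_unit_square by (simp add: state_space_def)
  have coord: "affine_fun_on ?K (\<lambda>x. x i)" "x \<in> ?K \<Longrightarrow> 0 \<le> x i \<and> x i \<le> 1" for i x
    by (auto simp: affine_fun_on_def mix_def unit_square_def)
       (metis One_nat_def less_2_cases_iff not_less order_refl zero_le_one)+
  \<comment> \<open>Coordinate \<open>l\<close> is itself an effect, and it separates the two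
    corners perfectly.\<close>
  have pair: "D ?K s {i, k} = 2"
    if "s i l = 1" "s k l = 0" "i \<noteq> k" "i \<in> {1, 2, 3}" "k \<in> {1, 2, 3}" for i k l
    using D_pair_ge[of ?K "\<lambda>x. x l" s i k] coord D_le_card[of s "{i, k}" ?K] that s K by auto
  have pairs: "D ?K s {1, 2} = 2" "D ?K s {1, 3} = 2" "D ?K s {2, 3} = 2"
    using pair[of 2 0 1] pair[of 3 1 1] pair[of 2 0 3]
    by (auto simp: s_def corner_def insert_commute)
  have "D ?K s {1, 2, 3} \<le> 2"
  proof -
    obtain e where e: "measurement ?K {1, 2, 3} e" "(\<Sum>i\<in>{1, 2, 3}. e i (s i)) = D ?K s {1, 2, 3}"
      using D_attained[OF s _ _ K] by blast
    have sum1: "e 1 x + e 2 x + e 3 x = 1" and pos: "0 \<le> e 1 x" "0 \<le> e 2 x" "0 \<le> e 3 x"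
      if "x \<in> ?K" for x
      using e(1) that by (auto simp: measurement_def)
    have aff: "e 1 (mix (1/2) x y) = e 1 x / 2 + e 1 y / 2" if "x \<in> ?K" "y \<in> ?K" for x y
      using e(1) that unfolding measurement_def affine_fun_on_def by auto
    \<comment> \<open>The diagonals share their midpoint. With nonnegativity of \<open>e 1\<close>
      at the fourth corner, \<open>e 1 (s 1)\<close> is at most
      \<open>e 1 (s 2) + e 1 (s 3)\<close>, so the success sum is bounded by the two normalisations
      at \<open>s 2\<close> and \<open>s 3\<close>.\<close>
    have "mix (1/2) (corner 0 0) (corner 1 1) = mix (1/2) (corner 1 0) (corner 0 1)"
      by (auto simp: mix_def corner_def)
    then have "e 1 (corner 0 0) + e 1 (corner 1 1) = e 1 (corner 1 0) + e 1 (corner 0 1)"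
      using aff[of "corner 0 0" "corner 1 1"] aff[of "corner 1 0" "corner 0 1"] corner_in by simp
    then show ?thesis
      using e(2) sum1[of "corner 1 0"] sum1[of "corner 0 1"] pos[of "corner 1 0"]
        pos[of "corner 0 1"] pos[of "corner 1 1"] corner_in
      by (simp add: s_def)
  qed
  moreover have "D ?K s {1, 2} \<le> D ?K s {1, 2, 3}"
    using s K by (intro D_mono) auto
  ultimately have "profile ?K s = (0, 0, 0, 1)"
    using pairs by (simp add: profile_def F_def)
  then show ?thesis
    unfolding gpt_region_def using s state_space_unit_square
    by (auto intro!: exI[of _ ?K] exI[of _ s] exI[of _ "2::nat"])
qed

theorem corollary5p4:
  shows "(\<forall>p\<in>gpt_region. p \<in> classical_region \<longleftrightarrow> beta p \<le> 0)
    \<and> ((\<exists>p\<in>classical_region. beta p = 0) \<and> (\<forall>p\<in>classical_region. beta p \<le> 0))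
    \<and> ((\<exists>p\<in>gpt_region. beta p = 1) \<and> (\<forall>p\<in>gpt_region. beta p \<le> 1))
    \<and> (\<forall>p\<in>gpt_region. beta p = 1 \<longrightarrow> p = (0, 0, 0, 1))"
proof (intro conjI)
  show "\<forall>p\<in>gpt_region. p \<in> classical_region \<longleftrightarrow> beta p \<le> 0"
  proof
    fix p assume p: "p \<in> gpt_region"
    obtain f12 f13 f23 f123 where f: "p = (f12, f13, f23, f123)"
      by (metis prod.exhaust)
    show "p \<in> classical_region \<longleftrightarrow> beta p \<le> 0"
      using classical_beta_le_0[of p] gpt_profile_bounds[OF p[unfolded f]]
        classical_region_sufficient[of f12 f13 f123 f23]
      by (auto simp: f)
  qed
  have "(0, 0, 0, 0) \<in> classical_region"
    by (rule classical_region_sufficient) auto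
  then show "\<exists>p\<in>classical_region. beta p = 0"
    by force
  show "\<forall>p\<in>classical_region. beta p \<le> 0"
    using classical_beta_le_0 by blast
  show "\<exists>p\<in>gpt_region. beta p = 1"
    using square_profile by force
  show "\<forall>p\<in>gpt_region. beta p \<le> 1"
    using gpt_profile_bounds by fastforce
  show "\<forall>p\<in>gpt_region. beta p = 1 \<longrightarrow> p = (0, 0, 0, 1)"
  proof (intro ballI impI)
    fix p assume p: "p \<in> gpt_region" "beta p = 1"
    obtain f12 f13 f23 f123 where f: "p = (f12, f13, f23, f123)"
      by (metis prod.exhaust)
    \<comment> \<open>\<open>f123 \<le> 1 + f12\<close> gives
      \<open>beta p \<le> 1 - f13 - f23\<close>, so equality forces \<open>f13 = f23 = 0\<close>.
      Dropping another hypothesis instead forces \<open>f12 = 0\<close>.\<close>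
    show "p = (0, 0, 0, 1)"
      using gpt_profile_bounds[OF p(1)[unfolded f]] p(2) by (simp add: f)
  qed
qed

end
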